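(* Let $F(n)$ be the Fibonacci numbers ($F(0)=0$, $F(1)=1$, $F(n)=F(n-1)+F(n-2)$) and let $p$ be a positive integer. Let $\mathbf{V}$ be the vector space of complex-valued functions on $\{0,1,2,\dots\}$, let $\mathbf{W}_p$ be the subspace spanned by the functions $n\mapsto F(n)^iF(n+1)^{p-i}$, $i=0,\dots,p$, and let $\mathbf{W}_p^{++}$ be the subspace spanned by these functions together with $g(n)=n$ and $h(n)=1$. Then (a) $\dim\mathbf{W}_p=p+1$, and (b) $\dim\mathbf{W}_p^{++}=p+2$ if $p$ is divisible by $4$ and $\dim\mathbf{W}_p^{++}=p+3$ otherwise. *)

theory Defs
  imports Complex_Main "HOL-Number_Theory.Fib" "HOL-Library.Function_Algebras"
begin

definition scale_fun :: "complex \<Rightarrow> (nat \<Rightarrow> complex) \<Rightarrow> (nat \<Rightarrow> complex)"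
  where "scale_fun c f = (\<lambda>n. c * f n)"

(* Addition on functions is the pointwise one from Function_Algebras. *)
global_interpretation cfun: vector_space scale_fun
  by standard (simp_all add: scale_fun_def fun_eq_iff algebra_simps)

definition fib_monomial :: "nat \<Rightarrow> nat \<Rightarrow> nat \<Rightarrow> complex"
  where "fib_monomial p i = (\<lambda>n. of_nat (fib n) ^ i * of_nat (fib (n + 1)) ^ (p - i))"

definition W :: "nat \<Rightarrow> (nat \<Rightarrow> complex) set"
  where "W p = cfun.span (fib_monomial p ` {0..p})"

definition Wpp :: "nat \<Rightarrow> (nat \<Rightarrow> complex) set"
  where "Wpp p = cfun.span (fib_monomial p ` {0..p} \<union> {\<lambda>n. of_nat n, \<lambda>n. 1})"

end

theory Submission
  imports Defs "HOL-Computational_Algebra.Polynomial"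
begin

text \<open>
  Let \<open>\<phi>, \<psi>\<close> be the roots of \<open>x\<^sup>2 = x + 1\<close>. Since \<open>\<phi>\<^sup>n = F(n+1) - \<psi> F(n)\<close> and
  \<open>\<psi>\<^sup>n = F(n+1) - \<phi> F(n)\<close>, the exponentials with the \<open>p + 1\<close> bases \<open>\<phi>\<^sup>i \<psi>\<^bsup>p-i\<^esup>\<close> lie in \<open>W p\<close>.
  The bases have distinct absolute values \<open>\<phi>\<^bsup>2i-p\<^esup>\<close>, and exponentials with distinct bases are
  linearly independent, even together with \<open>n \<mapsto> n\<close>; so these exponentials reach the trivial
  upper bounds on the dimensions. The base 1 occurs among them iff \<open>p = 2i\<close> and
  \<open>(\<phi>\<psi>)\<^sup>i = (-1)\<^sup>i = 1\<close>, that is, iff 4 divides \<open>p\<close>.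
\<close>

definition expf :: "complex \<Rightarrow> nat \<Rightarrow> complex"
  where "expf a = (\<lambda>n. a ^ n)"

lemma inj_expf: "inj expf"
proof (rule injI)
  fix a b assume "expf a = expf b"
  then have "expf a 1 = expf b 1" by simp
  then show "a = b" by (simp add: expf_def)
qed

lemma of_nat_neq_expf: "of_nat \<noteq> expf a"
proof
  assume "of_nat = expf a"
  then have "of_nat 0 = expf a 0" by simp
  then show False by (simp add: expf_def)
qed

text \<open>Applying the functional \<open>x\<^sup>n \<mapsto> \<Sum>a. d(a) a\<^sup>n + e n\<close> to a polynomial \<open>q\<close>.\<close>
lemma exp_relation_poly:
  fixes d :: "complex \<Rightarrow> complex" and q :: "complex poly"
  assumes "\<And>n. (\<Sum>a\<in>A. d a * a ^ n) + e * of_nat n = 0"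
  shows "(\<Sum>a\<in>A. d a * poly q a) + e * poly (pderiv q) 1 = 0"
proof -
  have monom: "poly (pderiv (monom c n)) 1 = c * of_nat n" for c :: complex and n
    by (simp add: pderiv_monom poly_monom mult.commute)
  have pd: "poly (pderiv q) 1 = (\<Sum>n\<le>degree q. coeff q n * of_nat n)"
    using higher_pderiv_sum[of 1 "\<lambda>n. monom (coeff q n) n" "{..degree q}"]
    by (simp add: poly_as_sum_of_monoms poly_sum monom)
  have "(\<Sum>a\<in>A. d a * poly q a) = (\<Sum>n\<le>degree q. \<Sum>a\<in>A. coeff q n * (d a * a ^ n))"
    by (subst sum.swap) (simp add: poly_altdef sum_distrib_left algebra_simps)
  then have "(\<Sum>a\<in>A. d a * poly q a) + e * poly (pderiv q) 1
      = (\<Sum>n\<le>degree q. coeff q n * ((\<Sum>a\<in>A. d a * a ^ n) + e * of_nat n))"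
    by (simp add: pd sum_distrib_left sum.distrib algebra_simps)
  then show ?thesis by (simp add: assms)
qed

text \<open>Each coefficient is isolated by testing the relation on a polynomial that kills all
  other terms. With \<open>1 \<in> A\<close>, the product of all \<open>x - b\<close> has a simple
  root at 1, so only the \<open>e\<close> term survives; once \<open>e = 0\<close>, omitting the
  factor \<open>x - a\<close> isolates \<open>d a\<close>.\<close>

lemma exp_relation_trivial:
  fixes d :: "complex \<Rightarrow> complex"
  assumes fin: "finite A" and one: "1 \<in> A"
    and rel: "\<And>n. (\<Sum>a\<in>A. d a * a ^ n) + e * of_nat n = 0"
  shows "e = 0" and "\<And>a. a \<in> A \<Longrightarrow> d a = 0"
proof -
  define r where "r B = (\<Prod>b\<in>B. [:-b, 1:])" for B :: "complex set"
  have r0: "poly (r B) x = 0 \<longleftrightarrow> x \<in> B" if "B \<subseteq> A" for B x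
    using finite_subset[OF that fin] by (auto simp: r_def poly_prod)
  \<comment> \<open>Product rule at the root 1: for \<open>q = r (A - {1})\<close> this value is
    nonzero.\<close>
  have pd: "poly (pderiv ([:-1, 1:] * q)) 1 = poly q 1" for q :: "complex poly"
    by (simp add: pderiv_mult pderiv_pCons del: mult_pCons_left)
  have single: "d a * poly q a + e * poly (pderiv q) 1 = 0"
    if "a \<in> A" "\<And>b. b \<in> A - {a} \<Longrightarrow> poly q b = 0" for a q
  proof -
    have "(\<Sum>a\<in>A. d a * poly q a) = d a * poly q a"
      using that by (simp add: sum.remove [OF fin])
    then show ?thesis using exp_relation_poly[OF rel, of q] by simp
  qed
  show e: "e = 0"
    using single[OF one, of "[:-1, 1:] * r (A - {1})"] r0[of "A - {1}"] pd[of "r (A - {1})"]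
    by (auto simp del: mult_pCons_left)
  show "d a = 0" if "a \<in> A" for a
    using single[OF that, of "r (A - {a})"] r0[of "A - {a}"] e by auto
qed

lemma independent_expf:
  assumes "finite A" "1 \<in> A"
  shows "cfun.independent (insert of_nat (expf ` A))"
proof (rule cfun.independent_if_scalars_zero)
  show "finite (insert of_nat (expf ` A))" using assms by simp
  fix f x
  assume sum0: "(\<Sum>x\<in>insert of_nat (expf ` A). scale_fun (f x) x) = 0"
    and x: "x \<in> insert of_nat (expf ` A)"
  have sum_app: "sum h B n = (\<Sum>b\<in>B. h b n)"
    for h :: "'b \<Rightarrow> nat \<Rightarrow> complex" and B n
    by (induction B rule: infinite_finite_induct) auto
  have ninA: "of_nat \<notin> expf ` A" using of_nat_neq_expf by auto
  have "(\<Sum>a\<in>A. f (expf a) * a ^ n) + f of_nat * of_nat n = 0" for n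
  proof -
    have "(\<Sum>x\<in>insert of_nat (expf ` A). scale_fun (f x) x) n = 0"
      using sum0 by simp
    then show ?thesis
      using ninA assms(1) inj_on_subset[OF inj_expf]
      by (simp add: sum_app sum.reindex scale_fun_def add.commute)
        (simp add: expf_def)
  qed
  from exp_relation_trivial[OF assms this] x show "f x = 0" by auto
qed

lemma card_insert_of_nat_expf:
  assumes "finite A"
  shows "card (insert of_nat (expf ` A)) = card A + 1"
proof -
  have "of_nat \<notin> expf ` A" using of_nat_neq_expf by auto
  then show ?thesis
    using assms inj_on_subset[OF inj_expf] by (simp add: card_image)
qed

text \<open>The spanning set \<open>T\<close> bounds the dimension above; extending \<open>S\<close>
  to a basis of \<open>span T\<close>, finite because \<open>T\<close> is, bounds it below.\<close>

lemma (in vector_space) dim_span_eq_card: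
  assumes "independent S" "S \<subseteq> span T" "finite T" "card T \<le> card S"
  shows "dim (span T) = card S"
proof (rule antisym)
  show "dim (span T) \<le> card S"
    using dim_le_card[of "span T" T] assms by simp
  have "finite S \<and> card S \<le> card T"
    using independent_span_bound assms by blast
  obtain B where B: "S \<subseteq> B" "B \<subseteq> span T" "independent B" "span T \<subseteq> span B"
    using maximal_independent_subset_extend[OF assms(2,1)] by blast
  have "finite B" using independent_span_bound[OF assms(3) B(3,2)] by simp
  then have "card S \<le> card B" using B(1) by (rule card_mono)
  also have "card B = dim (span T)" using basis_card_eq_dim[OF B(2,4,3)] .
  finally show "card S \<le> dim (span T)" .
qed

text \<open>Multiplying by a linear form in F(n), F(n+1) raises the degree of a form by one: the
  monomial with index \<open>i\<close> goes to a combination of those with indices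
  \<open>Suc i\<close> and \<open>i\<close>.\<close>

lemma W_mult_linear:
  assumes "f \<in> W p"
  shows "(\<lambda>n. (u * of_nat (fib n) + v * of_nat (fib (n + 1))) * f n) \<in> W (Suc p)"
  using assms unfolding W_def
proof (induction rule: cfun.span_induct_alt)
  case base
  then show ?case
    using cfun.span_zero by (simp add: zero_fun_def)
next
  case (step c m g)
  let ?S = "cfun.span (fib_monomial (Suc p) ` {0..Suc p})"
  let ?l = "\<lambda>n. u * of_nat (fib n) + v * of_nat (fib (n + 1)) :: complex"
  from step(1) obtain i where i: "i \<le> p" "m = fib_monomial p i" by auto
  have "scale_fun (c * u) (fib_monomial (Suc p) (Suc i)) +
      scale_fun (c * v) (fib_monomial (Suc p) i) + (\<lambda>n. ?l n * g n) \<in> ?S"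
    using i by (intro cfun.span_add cfun.span_scale step(2))
      (auto intro: cfun.span_base)
  also have "scale_fun (c * u) (fib_monomial (Suc p) (Suc i)) +
      scale_fun (c * v) (fib_monomial (Suc p) i) + (\<lambda>n. ?l n * g n)
      = (\<lambda>n. ?l n * (scale_fun c m + g) n)"
    using i by (simp add: fun_eq_iff fib_monomial_def scale_fun_def Suc_diff_le algebra_simps)
  finally show ?case .
qed

definition phi :: real where "phi = (1 + sqrt 5) / 2"
definition psi :: real where "psi = (1 - sqrt 5) / 2"

lemma phi_psi: "phi + psi = 1" "phi * psi = - 1"
  by (simp_all add: phi_def psi_def field_simps)

lemma phi_gt_1: "phi > 1"
  by (simp add: phi_def real_less_rsqrt)

lemma abs_psi: "\<bar>psi\<bar> = inverse phi"
proof -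
  have "psi = - inverse phi" using phi_psi(2) phi_gt_1 by (simp add: field_simps)
  moreover have "0 < inverse phi" using phi_gt_1 by simp
  ultimately show ?thesis by linarith
qed

text \<open>Stated for an abstract pair of roots, so that swapping \<open>x\<close> and
  \<open>y\<close> gives the formulas for both \<open>phi\<close> and \<open>psi\<close>.\<close>

lemma power_eq_fib:
  fixes x y :: "'a::comm_ring_1"
  assumes "x + y = 1" "x * y = - 1"
  shows "x ^ n = of_nat (fib (n + 1)) - y * of_nat (fib n)"
proof (induction n)
  case (Suc n)
  have "x ^ Suc n = x * of_nat (fib (n + 1)) - (x * y) * of_nat (fib n)"
    by (simp add: Suc algebra_simps)
  also have "\<dots> = (1 - y) * of_nat (fib (n + 1)) + of_nat (fib n)"
    unfolding assms(2) by (simp add: eq_diff_eq[THEN iffD2, OF assms(1)])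
  finally show ?case by (simp add: algebra_simps)
qed simp

definition fib_base :: "nat \<Rightarrow> nat \<Rightarrow> complex"
  where "fib_base p i = of_real (phi ^ i * psi ^ (p - i))"

lemma norm_fib_base: "cmod (fib_base p i) = phi ^ i * inverse phi ^ (p - i)"
  using phi_gt_1 by (simp add: fib_base_def norm_mult norm_power abs_psi)

lemma fib_base_inj: "inj_on (fib_base p) {0..p}"
proof -
  \<comment> \<open>As the index grows, the power of \<open>phi\<close> grows strictly and the power
    of \<open>inverse phi\<close> does not decrease.\<close>
  have "cmod (fib_base p i) < cmod (fib_base p j)" if "i < j" "j \<le> p" for i j
    unfolding norm_fib_base using that phi_gt_1
    by (intro mult_less_le_imp_less power_strict_increasing power_decreasing)
       (auto simp: inverse_le_1_iff)
  then show ?thesis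
    by (metis atLeastAtMost_iff inj_onI less_irrefl nat_neq_iff)
qed

lemma one_in_fib_base: "1 \<in> fib_base p ` {0..p} \<longleftrightarrow> 4 dvd p"
proof
  assume "1 \<in> fib_base p ` {0..p}"
  then obtain i where i: "i \<le> p" "fib_base p i = 1" by force
  \<comment> \<open>Absolute values force \<open>p = 2 * i\<close>; the sign then decides the parity
    of \<open>i\<close>.\<close>
  have "phi ^ i = phi ^ (p - i)"
    using norm_fib_base[of p i] i phi_gt_1 by (simp add: field_simps)
  then have p: "i = p - i" using phi_gt_1 power_inject_exp by blast
  have "phi ^ i * psi ^ (p - i) = 1"
    using i(2) unfolding fib_base_def of_real_eq_1_iff .
  then have "(phi * psi) ^ i = 1"
    using p by (simp add: power_mult_distrib)
  then have "even i" by (auto simp: phi_psi uminus_power_if split: if_splits)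
  moreover have "p = 2 * i" using p i by simp
  ultimately show "4 dvd p" by auto
next
  assume "4 dvd p"
  then obtain k where k: "p = 4 * k" by blast
  have "phi ^ (2 * k) * psi ^ (p - 2 * k) = (phi * psi) ^ (2 * k)"
    by (simp add: k power_mult_distrib)
  then have "fib_base p (2 * k) = 1" by (simp add: fib_base_def phi_psi)
  then show "1 \<in> fib_base p ` {0..p}"
    using k by (intro image_eqI[of _ _ "2 * k"]) auto
qed

lemma expf_fib_base_in_W:
  assumes "i \<le> p"
  shows "expf (fib_base p i) \<in> W p"
proof -
  have c: "complex_of_real phi + of_real psi = 1" "complex_of_real phi * of_real psi = - 1"
    using phi_psi by (simp_all flip: of_real_add of_real_mult)
  \<comment> \<open>Each factor is a linear form in F(n), F(n+1), so the degree must vary with the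
    number of factors for the induction to run.\<close>
  have "(\<lambda>n. (of_real phi ^ n) ^ i * (of_real psi ^ n) ^ j) \<in> W (i + j)" for i j
  proof (induction i)
    case 0
    show ?case
    proof (induction j)
      case 0
      have "fib_monomial 0 0 \<in> W 0" unfolding W_def by (rule cfun.span_base) simp
      then show ?case by (simp add: fib_monomial_def)
    next
      case (Suc j)
      have lin: "- of_real phi * of_nat (fib n) + of_nat (fib (n + 1)) = complex_of_real psi ^ n" for n
        using power_eq_fib[of "complex_of_real psi" "of_real phi" n] c
          by (simp add: algebra_simps)
      from W_mult_linear[OF Suc, of "- of_real phi" 1] show ?case
        by (simp only: lin power_0 power_Suc mult_1_left add_0 add_Suc mult.assoc)
    qed
  next
    case (Suc i)
    have lin: "- of_real psi * of_nat (fib n) + of_nat (fib (n + 1)) = complex_of_real phi ^ n" for n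
      using power_eq_fib[of "complex_of_real phi" "of_real psi" n] c
          by (simp add: algebra_simps)
    from W_mult_linear[OF Suc, of "- of_real psi" 1] show ?case
        by (simp only: lin power_0 power_Suc mult_1_left add_0 add_Suc mult.assoc)
  qed
  from this[of i "p - i"] show ?thesis
    using assms by (simp add: expf_def fib_base_def power_mult_distrib flip: power_mult)
      (simp add: mult.commute)
qed

theorem theorem5:
  fixes p :: nat
  assumes "p > 0"
  shows "cfun.dim (W p) = p + 1
    \<and> cfun.dim (Wpp p) = (if 4 dvd p then p + 2 else p + 3)"
proof
  let ?A = "fib_base p ` {0..p}" and ?M = "fib_monomial p ` {0..p}"
  have cardA: "card ?A = p + 1" by (simp add: card_image[OF fib_base_inj])
  have cardM: "card ?M \<le> p + 1" using card_image_le[of "{0..p}" "fib_monomial p"] by simp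
  have EW: "expf ` ?A \<subseteq> W p" using expf_fib_base_in_W by auto
  \<comment> \<open>One independent set serves both cases: inserting 1 adds a new base exactly when
    4 does not divide \<open>p\<close>.\<close>
  let ?S = "insert of_nat (expf ` insert 1 ?A)"
  have indep: "cfun.independent ?S" by (rule independent_expf) auto
  have one: "expf 1 = (\<lambda>n. 1)" by (simp add: expf_def fun_eq_iff)
  have cardE: "card (expf ` ?A) = p + 1"
    using card_image[OF inj_on_subset[OF inj_expf subset_UNIV]] cardA by metis
  have "cfun.dim (cfun.span ?M) = card (expf ` ?A)"
    using cfun.independent_mono[OF indep] EW cardM cardE
    by (intro cfun.dim_span_eq_card) (auto simp: W_def)
  then show "cfun.dim (W p) = p + 1" by (simp add: W_def cardE)

  have cardS: "card ?S = (if 4 dvd p then p + 2 else p + 3)"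
    using card_insert_of_nat_expf[of "insert 1 ?A"] cardA one_in_fib_base[of p]
    by (auto simp: insert_absorb card_insert_if)
  \<comment> \<open>If 4 divides \<open>p\<close>, the constant 1 already lies in
    \<open>W p\<close>. Dropping it from the generators keeps the span and makes the upper bound
    match \<open>card ?S\<close>.\<close>
  define T where "T = (if 4 dvd p then insert of_nat ?M else ?M \<union> {of_nat, \<lambda>n. 1})"
  have WT: "W p \<subseteq> cfun.span T"
    unfolding W_def by (rule cfun.span_mono) (auto simp: T_def)
  have oneT: "(\<lambda>n. 1) \<in> cfun.span T"
  proof (cases "4 dvd p")
    case True
    then have "expf 1 \<in> W p" using EW one_in_fib_base by blast
    then show ?thesis using WT one by auto
  next
    case False
    then show ?thesis by (intro cfun.span_base) (simp add: T_def)
  qed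
  have natT: "of_nat \<in> cfun.span T" by (intro cfun.span_base) (simp add: T_def)
  have "Wpp p = cfun.span T"
  proof
    show "Wpp p \<subseteq> cfun.span T"
      unfolding Wpp_def using WT oneT natT
      by (intro cfun.span_minimal) (auto simp: W_def intro: cfun.span_base)
    show "cfun.span T \<subseteq> Wpp p"
      unfolding Wpp_def T_def by (rule cfun.span_mono) auto
  qed
  moreover have "card T \<le> card ?S"
    using cardM unfolding cardS T_def
    by (auto intro!: card_insert_le_m1 simp: card_insert_if)
  then have "cfun.dim (cfun.span T) = card ?S"
    using indep EW WT oneT natT
    by (intro cfun.dim_span_eq_card) (auto simp: one T_def)
  ultimately show "cfun.dim (Wpp p) = (if 4 dvd p then p + 2 else p + 3)"
    using cardS by simp
qed

end
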